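(* Let $p$ be a prime with $p\equiv 3\pmod 4$, let $q$ be a prime power with $q\equiv 3\pmod 4$ and $\gcd(p,q)=1$, set $n=2p$, and assume $\mathrm{ord}_{4p}(q)=p-1$ and $\mathrm{ord}_p(q)\equiv 2\pmod 4$ (so that $x^n+1=(x^2+1)g_1(x)g_2(x)$ over $\mathbb{F}_q$ with $g_1,g_2$ irreducible self-reciprocal of degree $p-1$). Then: (1) the number of elements $h\in R$ such that the double-negacirculant code $C_h$ of length $2n$ is self-dual equals $(q+1)\left(q^{\frac{p-1}{2}}+1\right)^2$; (2) the number of pairs $(a,b)\in R^2$ such that the four-negacirculant code $C_{a,b}$ of length $4n$ is self-dual equals $$(q+1)(q^2-q)\left(q^{\frac{p-1}{2}}+1\right)^2\left(q^{p-1}-q^{\frac{p-1}{2}}\right)^2.$$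
   Context: $R=\mathbb{F}_q[x]/\langle x^n+1\rangle$; an element $a=a_0+a_1x+\dots+a_{n-1}x^{n-1}\in R$ is identified with its coefficient vector, and its associated negacirculant matrix is the $n\times n$ matrix with first row $(a_0,\dots,a_{n-1})$ whose each subsequent row is the negashift $(x_0,\dots,x_{n-1})\mapsto(-x_{n-1},x_0,\dots,x_{n-2})$ of the previous one. For $h\in R$ with negacirculant matrix $H$, $C_h$ is the $[2n,n]$ code over $\mathbb{F}_q$ generated by $(I_n\ H)$ (as an $R$-module, generated by $(1,h)$). For $a,b\in R$ with negacirculant matrices $A,B$, $C_{a,b}$ is the $[4n,2n]$ code generated by $\begin{pmatrix} I_n & 0 & A & B\\ 0 & I_n & -B^t & A^t\end{pmatrix}$ (as an $R$-module in $R^4$, generated by $(1,0,a,b)$ and $(0,1,-b',a')$, where $a'(x)=a(-x^{n-1}) \bmod x^n+1$, $b'(x)=b(-x^{n-1}) \bmod x^n+1$). Self-dual means equal to its dual with respect to the standard Euclidean inner product. $\mathrm{ord}_m(q)$ is the multiplicative order of $q$ modulo $m$; a polynomial $f$ with $f(0)\ne0$ is self-reciprocal if $f(0)^{-1}x^{\deg f}f(x^{-1})=f(x)$. *)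

theory Defs
  imports "HOL-Number_Theory.Number_Theory" "HOL-Library.Cardinality"
begin

text \<open>Elements of R = F_q[x]/(x^n+1) are identified with coefficient vectors,
  represented as functions nat => 'a vanishing from index n on.
  Vectors of length N likewise are functions vanishing from index N on.\<close>

definition vecs :: "nat \<Rightarrow> (nat \<Rightarrow> 'a::zero) set" where
  "vecs N = {v. \<forall>j\<ge>N. v j = 0}"

definition negacirc :: "nat \<Rightarrow> (nat \<Rightarrow> 'a::ring_1) \<Rightarrow> nat \<Rightarrow> nat \<Rightarrow> 'a" where
  "negacirc n a i j = (if i \<le> j then a (j - i) else - a (n + j - i))"

definition span_code :: "nat \<Rightarrow> nat \<Rightarrow> (nat \<Rightarrow> nat \<Rightarrow> 'a::comm_ring_1) \<Rightarrow> (nat \<Rightarrow> 'a) set" where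
  "span_code k N G = {v. \<exists>c. v = (\<lambda>j. if j < N then (\<Sum>i<k. c i * G i j) else 0)}"

definition dual_code :: "nat \<Rightarrow> (nat \<Rightarrow> 'a::comm_ring_1) set \<Rightarrow> (nat \<Rightarrow> 'a) set" where
  "dual_code N C = {v \<in> vecs N. \<forall>c\<in>C. (\<Sum>j<N. v j * c j) = 0}"

definition self_dual :: "nat \<Rightarrow> (nat \<Rightarrow> 'a::comm_ring_1) set \<Rightarrow> bool" where
  "self_dual N C \<longleftrightarrow> C = dual_code N C"

definition gen_h :: "nat \<Rightarrow> (nat \<Rightarrow> 'a::comm_ring_1) \<Rightarrow> nat \<Rightarrow> nat \<Rightarrow> 'a" where
  "gen_h n h i j = (if j < n then (if i = j then 1 else 0) else negacirc n h i (j - n))"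

definition code_h :: "nat \<Rightarrow> (nat \<Rightarrow> 'a::comm_ring_1) \<Rightarrow> (nat \<Rightarrow> 'a) set" where
  "code_h n h = span_code n (2 * n) (gen_h n h)"

text \<open>Generator matrix [[I_n, 0, A, B], [0, I_n, -B^t, A^t]] of C_{a,b}.\<close>
definition gen_ab :: "nat \<Rightarrow> (nat \<Rightarrow> 'a::comm_ring_1) \<Rightarrow> (nat \<Rightarrow> 'a) \<Rightarrow> nat \<Rightarrow> nat \<Rightarrow> 'a" where
  "gen_ab n a b i j =
    (if i < n then
       (if j < n then (if i = j then 1 else 0)
        else if j < 2 * n then 0
        else if j < 3 * n then negacirc n a i (j - 2 * n)
        else negacirc n b i (j - 3 * n))
     else
       (if j < n then 0
        else if j < 2 * n then (if i - n = j - n then 1 else 0)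
        else if j < 3 * n then - negacirc n b (j - 2 * n) (i - n)
        else negacirc n a (j - 3 * n) (i - n)))"

definition code_ab :: "nat \<Rightarrow> (nat \<Rightarrow> 'a::comm_ring_1) \<Rightarrow> (nat \<Rightarrow> 'a) \<Rightarrow> (nat \<Rightarrow> 'a) set" where
  "code_ab n a b = span_code (2 * n) (4 * n) (gen_ab n a b)"

end

theory Submission
  imports "HOL-Algebra.Algebraic_Closure_Type" Defs
begin

text \<open>Evaluating coefficient vectors at the \<open>n\<close> roots of \<open>x ^ n + 1\<close> in an algebraic closure
  diagonalises all negacirculant matrices simultaneously, transposition corresponding to
  \<open>z \<mapsto> inverse z\<close>. So \<open>C\<^sub>h\<close> is self-dual iff \<open>h(z) h(inverse z) = -1\<close> at every root, and
  \<open>C\<^sub>a\<^sub>,\<^sub>b\<close> iff \<open>a(z) a(inverse z) + b(z) b(inverse z) = -1\<close>. The hypotheses on orders say that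
  the roots form three Frobenius orbits, each closed under inversion. One representative per orbit
  identifies \<open>R\<close> with a product of three fields of orders \<open>q\<^sup>2\<close>, \<open>q ^ (p - 1)\<close>, \<open>q ^ (p - 1)\<close>, in each
  of which inversion of the root becomes conjugation over the subfield of index 2. What remains is
  to count the solutions of \<open>N x = -1\<close> and \<open>N x + N y = -1\<close> for the norm \<open>N\<close>.\<close>

section \<open>Finite fields inside an algebraic closure\<close>

lemma finite_field_power_card:
  fixes x :: "'a::{finite,field}"
  shows "x ^ CARD('a) = x"
proof (cases "x = 0")
  case False
  have "bij_betw ((*) x) (UNIV - {0}) (UNIV - {0})"
    by (rule bij_betw_byWitness[of _ "\<lambda>y. y / x"]) (use False in auto)
  then have "(\<Prod>y\<in>UNIV - {0}. x * y) = \<Prod>(UNIV - {0})"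
    by (rule prod.reindex_bij_betw)
  then have "x ^ (CARD('a) - 1) = 1"
    by (simp add: prod.distrib card_Diff_subset)
  moreover have "CARD('a) = Suc (CARD('a) - 1)" by simp
  ultimately show ?thesis
    by (metis mult.right_neutral power_Suc)
qed (simp add: power_0_left)

lemma of_nat_binomial_card_eq_0:
  assumes "0 < k" "k < CARD('a)"
  shows "of_nat (CARD('a) choose k) = (0 :: 'a::{finite,field})"
proof -
  let ?q = "CARD('a)"
  define P :: "'a poly" where "P = (\<Sum>i\<in>{0<..<?q}. monom (of_nat (?q choose i)) i)"
  have coeff_P: "coeff P i = (if i \<in> {0<..<?q} then of_nat (?q choose i) else 0)" for i
    by (simp add: P_def coeff_sum)
  have root: "poly P x = 0" for x
  proof -
    have "{..?q} = insert 0 (insert ?q {0<..<?q})" by auto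
    then have "(x + 1) ^ ?q = x ^ ?q + (1 + poly P x)"
      by (simp add: binomial_ring P_def poly_sum poly_monom)
    then show ?thesis by (simp add: finite_field_power_card)
  qed
  have "P = 0"
  proof (rule ccontr)
    assume "P \<noteq> 0"
    then have "?q \<le> degree P"
      using card_poly_roots_bound[of P] root by simp
    moreover have "degree P < ?q"
      using coeff_P[of "degree P"] \<open>P \<noteq> 0\<close> leading_coeff_0_iff[of P] by (metis greaterThanLessThan_iff)
    ultimately show False by simp
  qed
  then show ?thesis using coeff_P[of k] assms by simp
qed

lemma frobenius_add:
  fixes x y :: "'a::{finite,field} alg_closure"
  shows "(x + y) ^ (CARD('a) ^ m) = x ^ (CARD('a) ^ m) + y ^ (CARD('a) ^ m)"
proof (induction m)
  case (Suc m)
  let ?q = "CARD('a)"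
  have step: "(u + v) ^ ?q = u ^ ?q + v ^ ?q" for u v :: "'a alg_closure"
  proof -
    have "of_nat (?q choose i) = (0 :: 'a alg_closure)" if "i \<in> {0<..<?q}" for i
      using that of_nat_binomial_card_eq_0[where 'a='a, of i] to_ac_of_nat[of "?q choose i", where 'a='a] 
      by (metis greaterThanLessThan_iff to_ac_0)
    moreover have "{..?q} = insert 0 (insert ?q {0<..<?q})" by auto
    ultimately show ?thesis by (simp add: binomial_ring)
  qed
  show ?case
    by (simp only: power_Suc2 power_mult Suc.IH step)
qed simp

lemma frobenius_sum:
  fixes f :: "'b \<Rightarrow> 'a::{finite,field} alg_closure"
  shows "(\<Sum>i\<in>A. f i) ^ (CARD('a) ^ m) = (\<Sum>i\<in>A. f i ^ (CARD('a) ^ m))"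
  by (induction A rule: infinite_finite_induct) (auto simp: frobenius_add power_0_left)

lemma to_ac_power_card: "to_ac x ^ (CARD('a) ^ m) = to_ac (x :: 'a::{finite,field})"
  by (induction m) (simp_all add: power_mult finite_field_power_card flip: to_ac_power)

lemma card_roots_separable:
  fixes P :: "'b::alg_closed_field poly"
  assumes "P \<noteq> 0" and sep: "\<And>x. poly P x = 0 \<Longrightarrow> poly (pderiv P) x \<noteq> 0"
  shows "card {x. poly P x = 0} = degree P"
proof -
  obtain A where A: "size A = degree P" "P = smult (lead_coeff P) (\<Prod>x\<in>#A. [:-x, 1:])"
    using alg_closed_imp_factorization[OF \<open>P \<noteq> 0\<close>] by blast
  have lc: "lead_coeff P \<noteq> 0" using assms by simp
  have roots: "{x. poly P x = 0} = set_mset A"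
    using lc by (subst A(2)) (auto simp: poly_prod_mset prod_mset_zero_iff)
  have "count A x \<le> 1" for x
  proof (rule ccontr)
    assume "\<not> count A x \<le> 1"
    then have "add_mset x {#x#} \<subseteq># A"
      by (simp add: subseteq_mset_def)
    then obtain B where "A = add_mset x {#x#} + B"
      by (meson mset_subset_eq_exists_conv)
    then have "P = [:-x, 1:] * ([:-x, 1:] * smult (lead_coeff P) (\<Prod>x\<in>#B. [:-x, 1:]))"
      by (subst A(2)) (simp add: mult_ac)
    then obtain R where "P = [:-x, 1:] * ([:-x, 1:] * R)" by blast
    then have "poly P x = 0" "poly (pderiv P) x = 0" by (simp_all add: pderiv_mult pderiv_pCons del: mult_pCons_left)
    with sep show False by blast
  qed
  then have "size A = card (set_mset A)"
    by (metis (no_types, lifting) One_nat_def card_eq_sum count_greater_zero_iff le_antisym less_Suc_eq_le linorder_not_less not_gr0 size_multiset_overloaded_eq sum.cong)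
  with A roots show ?thesis by simp
qed

lemma card_power_eq:
  fixes c :: "'b::alg_closed_field"
  assumes "of_nat m \<noteq> (0 :: 'b)" "c \<noteq> 0"
  shows "card {x. x ^ m = c} = m" "finite {x. x ^ m = c}"
proof -
  have m: "m > 0" using assms by (cases m) auto
  let ?P = "monom 1 m - [:c:]"
  have deg: "degree ?P = m"
    using m unfolding diff_conv_add_uminus by (subst degree_add_eq_left) (auto simp: degree_monom_eq)
  then have nz: "?P \<noteq> 0" using m by auto
  have "card {x. poly ?P x = 0} = degree ?P"
  proof (rule card_roots_separable[OF nz])
    fix x assume "poly ?P x = 0"
    then have "x \<noteq> 0" using assms m by (auto simp: poly_monom power_0_left)
    then show "poly (pderiv ?P) x \<noteq> 0"
      using assms by (simp add: pderiv_diff pderiv_monom poly_monom pderiv_pCons)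
  qed
  then show "card {x. x ^ m = c} = m" by (simp add: deg poly_monom)
  show "finite {x. x ^ m = c}" using poly_roots_finite[OF nz] by (simp add: poly_monom)
qed

definition fixed_field :: "nat \<Rightarrow> 'a::{finite,field} alg_closure set" where
  "fixed_field m = {x. x ^ (CARD('a) ^ m) = x}"

lemma of_nat_card_eq_0: "of_nat CARD('a::{finite,field}) = (0 :: 'a alg_closure)"
  by (simp add: of_nat_eq_0_iff_char_dvd CHAR_dvd_CARD)

lemma card_gt_1: "CARD('a::{finite,field}) > 1"
proof -
  have "card {0, 1::'a} \<le> CARD('a)" by (intro card_mono) auto
  then show ?thesis by simp
qed

lemma card_fixed_field:
  assumes "m > 0"
  shows "card (fixed_field m :: 'a::{finite,field} alg_closure set) = CARD('a) ^ m"
    and "finite (fixed_field m :: 'a alg_closure set)"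
proof -
  let ?P = "monom 1 (CARD('a) ^ m) - [:0, 1:] :: 'a alg_closure poly"
  have gt: "CARD('a) ^ m > 1" by (rule one_less_power[OF card_gt_1 assms])
  then have deg: "degree ?P = CARD('a) ^ m"
    unfolding diff_conv_add_uminus by (subst degree_add_eq_left) (auto simp: degree_monom_eq)
  then have nz: "?P \<noteq> 0" using gt by force
  have "card {x. poly ?P x = 0} = degree ?P"
    using assms by (intro card_roots_separable[OF nz])
      (simp add: pderiv_diff pderiv_monom poly_monom pderiv_pCons of_nat_card_eq_0 power_0_left)
  then show "card (fixed_field m :: 'a alg_closure set) = CARD('a) ^ m"
    by (simp add: deg poly_monom fixed_field_def)
  show "finite (fixed_field m :: 'a alg_closure set)"
    using poly_roots_finite[OF nz] by (simp add: poly_monom fixed_field_def)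
qed

text \<open>On \<open>fixed_field (2 * t)\<close>, a field with \<open>s ^ 2\<close> elements for \<open>s = CARD('a) ^ t\<close>,
  the map \<open>x \<mapsto> x ^ (s + 1)\<close> is the norm to the subfield \<open>fixed_field t\<close>.\<close>

lemma card_norm_eq:
  fixes c :: "'a::{finite,field} alg_closure"
  assumes t: "t > 0" and c: "c \<in> fixed_field t" "c \<noteq> 0"
  defines "s \<equiv> CARD('a) ^ t"
  shows "card {x \<in> fixed_field (2 * t). x ^ (s + 1) = c} = s + 1"
proof -
  have s: "s > 1" unfolding s_def by (rule one_less_power[OF card_gt_1 t])
  have c': "c ^ s = c" using c by (simp add: fixed_field_def s_def)
  have "x \<in> fixed_field (2 * t)" if x: "x ^ (s + 1) = c" for x
  proof -
    have x0: "x \<noteq> 0" using x c by auto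
    have "(x ^ s) ^ s * (x ^ s) = (x ^ (s + 1)) ^ s"
      by (simp add: power_mult_distrib)
    also have "\<dots> = x * x ^ s" using x c' by simp
    finally have "(x ^ s) ^ s = x" using x0 by simp
    then show ?thesis
      by (simp add: fixed_field_def mult_2 power_add power_mult s_def)
  qed
  then have "{x \<in> fixed_field (2 * t). x ^ (s + 1) = c} = {x. x ^ (s + 1) = c}" by auto
  moreover have "of_nat (s + 1) \<noteq> (0 :: 'a alg_closure)"
    using t by (simp add: s_def of_nat_card_eq_0 power_0_left)
  ultimately show ?thesis using card_power_eq(1) c by metis
qed

lemma norm_in_fixed_field:
  fixes x :: "'a::{finite,field} alg_closure"
  assumes "x \<in> fixed_field (2 * t)"
  shows "x ^ (CARD('a) ^ t + 1) \<in> fixed_field t"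
proof -
  have "(x ^ (CARD('a) ^ t)) ^ (CARD('a) ^ t) = x"
    using assms by (simp add: fixed_field_def mult_2 power_add power_mult)
  then show ?thesis by (simp add: fixed_field_def power_mult_distrib mult.commute)
qed

lemma card_norm_add_norm_eq:
  assumes t: "t > 0" and odd: "odd CARD('a::{finite,field})"
  defines "s \<equiv> CARD('a) ^ t"
  defines "K \<equiv> fixed_field (2 * t) :: 'a alg_closure set"
  shows "card {(x, y) \<in> K \<times> K. x ^ (s + 1) + y ^ (s + 1) = -1} = (s + 1) * (s ^ 2 - s)"
proof -
  let ?N = "\<lambda>x::'a alg_closure. x ^ (s + 1)"
  have s: "s > 1" unfolding s_def by (rule one_less_power[OF card_gt_1 t])
  have fin: "finite K" and card_K: "card K = s ^ 2"
    using card_fixed_field[of "2 * t", where 'a = 'a] t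
    by (simp_all add: K_def s_def power_mult[symmetric] mult.commute)
  have neg: "- c \<in> fixed_field t" if "c \<in> fixed_field t" for c :: "'a alg_closure"
    using that odd by (simp add: fixed_field_def)
  have one: "1 \<in> (fixed_field t :: 'a alg_closure set)" by (simp add: fixed_field_def)
  have add: "x + y \<in> fixed_field t" if "x \<in> fixed_field t" "y \<in> fixed_field t" for x y :: "'a alg_closure"
    using that by (simp add: fixed_field_def frobenius_add)
  have fibre: "card {y \<in> K. ?N x + ?N y = -1} = (if ?N x = -1 then 1 else s + 1)" if "x \<in> K" for x
  proof -
    have "u + v = -1 \<longleftrightarrow> v = - (u + 1)" for u v :: "'a alg_closure"
      by (simp only: eq_neg_iff_add_eq_0 add_ac)
    then have eq: "{y \<in> K. ?N x + ?N y = -1} = {y \<in> K. ?N y = - (?N x + 1)}" by blast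
    have "- (?N x + 1) \<in> fixed_field t"
      using norm_in_fixed_field[of x t] that by (intro neg add one) (simp_all add: K_def s_def)
    moreover have "- (?N x + 1) \<noteq> 0" if "?N x \<noteq> -1"
      using that by (simp only: neg_equal_0_iff_equal add_eq_0_iff2 not_False_eq_True)
    ultimately have "card {y \<in> K. ?N y = - (?N x + 1)} = s + 1" if "?N x \<noteq> -1"
      using that card_norm_eq[OF t, of "- (?N x + 1)"] unfolding K_def s_def by blast
    moreover have "0 \<in> K" by (simp add: K_def fixed_field_def power_0_left)
    then have "{y \<in> K. ?N x + ?N y = -1} = {0}" if "?N x = -1"
      unfolding that by auto
    ultimately show ?thesis using eq by auto
  qed
  have fin1: "finite {x \<in> K. ?N x = -1}" using fin by simp
  have m1: "card {x \<in> K. ?N x = -1} = s + 1"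
    using card_norm_eq[OF t neg[OF one]] unfolding K_def s_def by simp
  have "{(x, y) \<in> K \<times> K. ?N x + ?N y = -1} = (SIGMA x:K. {y \<in> K. ?N x + ?N y = -1})" by auto
  then have "card {(x, y) \<in> K \<times> K. ?N x + ?N y = -1} = (\<Sum>x\<in>K. if ?N x = -1 then 1 else s + 1)"
    using fin fibre by (simp add: card_SigmaI)
  also have "\<dots> = card {x \<in> K. ?N x = -1} + card {x \<in> K. ?N x \<noteq> -1} * (s + 1)"
  proof -
    have "K = {x \<in> K. ?N x = -1} \<union> {x \<in> K. ?N x \<noteq> -1}" by blast
    then have "(\<Sum>x\<in>K. if ?N x = -1 then 1 else s + 1) =
        (\<Sum>x\<in>{x \<in> K. ?N x = -1}. if ?N x = -1 then 1 else s + 1) +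
        (\<Sum>x\<in>{x \<in> K. ?N x \<noteq> -1}. if ?N x = -1 then 1 else s + 1)"
      by (subst sum.union_disjoint[symmetric]) (use fin in auto)
    then show ?thesis by simp
  qed
  also have "{x \<in> K. ?N x \<noteq> -1} = K - {x \<in> K. ?N x = -1}" by auto
  also have "card \<dots> = s ^ 2 - (s + 1)"
    by (simp only: card_Diff_subset[OF fin1 Collect_restrict] card_K m1)
  also have "card {x \<in> K. ?N x = -1} = s + 1" by (rule m1)
  also have "(s + 1) + (s ^ 2 - (s + 1)) * (s + 1) = (s + 1) * (s ^ 2 - s)"
  proof -
    have "2 * s \<le> s ^ 2" using s by (simp add: power2_eq_square)
    then obtain d where d: "s ^ 2 = s + 1 + d" using s le_Suc_ex[of "s + 1" "s ^ 2"] by auto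
    show ?thesis unfolding d by (simp add: algebra_simps)
    qed
  finally show ?thesis .
qed

section \<open>Evaluation of coefficient vectors\<close>

lemma card_vecs: "card (vecs n :: (nat \<Rightarrow> 'a::{finite,zero}) set) = CARD('a) ^ n"
proof -
  have "bij_betw (\<lambda>v. restrict v {..<n}) (vecs n :: (nat \<Rightarrow> 'a) set) ({..<n} \<rightarrow>\<^sub>E UNIV)"
    by (rule bij_betw_byWitness[of _ "\<lambda>v j. if j < n then v j else 0"])
      (auto simp: vecs_def PiE_def extensional_def fun_eq_iff)
  from bij_betw_same_card[OF this] show ?thesis by (simp add: card_PiE)
qed

definition ev :: "nat \<Rightarrow> (nat \<Rightarrow> 'a::field) \<Rightarrow> 'a alg_closure \<Rightarrow> 'a alg_closure" where
  "ev n v z = (\<Sum>j<n. to_ac (v j) * z ^ j)"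

lemma ev_cong: "(\<And>j. j < n \<Longrightarrow> v j = w j) \<Longrightarrow> ev n v z = ev n w z"
  by (simp add: ev_def)

lemma ev_add: "ev n (\<lambda>j. v j + w j) z = ev n v z + ev n w z"
  and ev_diff: "ev n (\<lambda>j. v j - w j) z = ev n v z - ev n w z"
  and ev_uminus: "ev n (\<lambda>j. - v j) z = - ev n v z"
  by (simp_all add: ev_def algebra_simps sum.distrib sum_subtractf sum_negf)

lemma ev_zero: "ev n (\<lambda>j. 0) z = 0"
  by (simp add: ev_def)

lemma ev_unit: "n > 0 \<Longrightarrow> ev n (\<lambda>j. if j = 0 then 1 else 0) z = 1"
  by (simp add: ev_def if_distrib[where f = to_ac] if_distrib[where f = "\<lambda>x. x * _"] sum.delta cong: if_cong)

lemma ev_frobenius: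
  fixes v :: "nat \<Rightarrow> 'a::{finite,field}"
  shows "ev n v z ^ (CARD('a) ^ m) = ev n v (z ^ (CARD('a) ^ m))"
  by (simp add: ev_def frobenius_sum power_mult_distrib to_ac_power_card power_mult[symmetric] mult.commute)

lemma ev_eq_imp_eq:
  assumes "card Z \<ge> n" and ev: "\<And>z. z \<in> Z \<Longrightarrow> ev n v z = ev n w z" and "j < n"
  shows "v j = w j"
proof -
  define P where "P = (\<Sum>i<n. monom (to_ac (v i - w i)) i)"
  have coeff_P: "coeff P i = (if i < n then to_ac (v i - w i) else 0)" for i
    by (simp add: P_def coeff_sum)
  have roots: "Z \<subseteq> {z. poly P z = 0}"
    using ev by (auto simp: P_def poly_sum poly_monom ev_def algebra_simps sum_subtractf)
  have "P = 0"
  proof (rule ccontr)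
    assume "P \<noteq> 0"
    then have "card Z \<le> degree P"
      using card_mono[OF poly_roots_finite roots] card_poly_roots_bound[of P] by fastforce
    moreover have "degree P < n"
      using coeff_P[of "degree P"] \<open>P \<noteq> 0\<close> by (metis leading_coeff_0_iff)
    ultimately show False using assms(1) by simp
  qed
  then show ?thesis using coeff_P[of j] \<open>j < n\<close> by simp
qed

text \<open>Powers of a root \<open>z\<close> of \<open>x ^ n + 1\<close> form an eigenvector of every negacirculant matrix,
  and of its transpose.\<close>

lemma ev_negacirc_row:
  assumes "z ^ n = -1" "i < n"
  shows "ev n (negacirc n a i) z = z ^ i * ev n a z"
proof -
  have "ev n (negacirc n a i) z = (\<Sum>j<n. to_ac (a j) * z ^ (i + j))"
    unfolding ev_def
  proof (rule sum.reindex_bij_witness[where i = "\<lambda>j. if i + j < n then i + j else i + j - n"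
        and j = "\<lambda>j. if i \<le> j then j - i else n + j - i"], goal_cases)
    case (5 j)
    show ?case
    proof (cases "i \<le> j")
      case False
      with assms have "z ^ (i + (n + j - i)) = - (z ^ j)" by (simp add: power_add)
      with False show ?thesis using assms by (simp add: negacirc_def)
    qed (simp add: negacirc_def)
  qed (use assms in \<open>auto split: if_splits\<close>)
  then show ?thesis by (simp add: ev_def sum_distrib_left power_add mult_ac)
qed

lemma ev_negacirc_col:
  assumes "z ^ n = -1" "i < n"
  shows "ev n (\<lambda>j. negacirc n a j i) z = z ^ i * ev n a (inverse z)"
proof -
  have z: "z \<noteq> 0" using assms by (auto simp: power_0_left)
  have "ev n (\<lambda>j. negacirc n a j i) z = (\<Sum>j<n. to_ac (a j) * (z ^ i * inverse z ^ j))"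
    unfolding ev_def
  proof (rule sum.reindex_bij_witness[where i = "\<lambda>j. if j \<le> i then i - j else n + i - j"
        and j = "\<lambda>j. if j \<le> i then i - j else n + i - j"], goal_cases)
    case (5 j)
    show ?case
    proof (cases "j \<le> i")
      case True
      then have "z ^ i = z ^ (i - j) * z ^ j" by (simp add: power_add[symmetric])
      with True z show ?thesis by (simp add: negacirc_def power_inverse)
    next
      case False
      with 5 have "z ^ (n + i - j) * z ^ j = z ^ n * z ^ i" by (simp add: power_add[symmetric])
      then have "z ^ i * inverse z ^ (n + i - j) = - (z ^ j)"
        using z assms by (simp add: field_simps)
      with False show ?thesis by (simp add: negacirc_def)
    qed
  qed (use assms in \<open>auto split: if_splits\<close>)
  then show ?thesis by (simp add: ev_def sum_distrib_left mult_ac)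
qed

lemma ev_vec_negacirc:
  assumes "z ^ n = -1"
  shows "ev n (\<lambda>j. \<Sum>i<n. v i * negacirc n a i j) z = ev n v z * ev n a z"
proof -
  have "ev n (\<lambda>j. \<Sum>i<n. v i * negacirc n a i j) z = (\<Sum>i<n. to_ac (v i) * ev n (negacirc n a i) z)"
    unfolding ev_def to_ac_sum sum_distrib_right sum_distrib_left by (subst sum.swap) (simp add: mult_ac)
  also have "\<dots> = (\<Sum>i<n. to_ac (v i) * z ^ i) * ev n a z"
    by (simp add: ev_negacirc_row assms sum_distrib_left sum_distrib_right mult_ac)
  finally show ?thesis by (simp add: ev_def)
qed

lemma ev_negacirc_vec:
  assumes "z ^ n = -1"
  shows "ev n (\<lambda>i. \<Sum>j<n. negacirc n a i j * v j) z = ev n v z * ev n a (inverse z)"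
proof -
  have "ev n (\<lambda>i. \<Sum>j<n. negacirc n a i j * v j) z = (\<Sum>j<n. to_ac (v j) * ev n (\<lambda>i. negacirc n a i j) z)"
    unfolding ev_def to_ac_sum sum_distrib_right sum_distrib_left by (subst sum.swap) (simp add: mult_ac)
  also have "\<dots> = (\<Sum>i<n. to_ac (v i) * z ^ i) * ev n a (inverse z)"
    by (simp add: ev_negacirc_col assms sum_distrib_left sum_distrib_right mult_ac)
  finally show ?thesis by (simp add: ev_def)
qed

section \<open>Self-duality at the roots\<close>

lemma mem_span_code_systematic:
  assumes G: "\<And>i j. i < k \<Longrightarrow> j < k \<Longrightarrow> G i j = (if i = j then 1 else 0)" and "k \<le> N"
  shows "v \<in> span_code k N G \<longleftrightarrow> v \<in> vecs N \<and> (\<forall>j\<in>{k..<N}. v j = (\<Sum>i<k. v i * G i j))"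
    (is "?l \<longleftrightarrow> ?r")
proof
  have unit: "(\<Sum>i<k. c i * G i j) = c j" if "j < k" for c j
    using that G by (simp add: if_distrib[where f = "\<lambda>x. _ * x"] cong: if_cong)
  show ?r if ?l
  proof -
    obtain c where c: "v = (\<lambda>j. if j < N then (\<Sum>i<k. c i * G i j) else 0)"
      using \<open>?l\<close> by (auto simp: span_code_def)
    have "v i = c i" if "i < k" for i
      using unit[OF that] that assms(2) by (simp add: c)
    then show ?r by (auto simp: c vecs_def)
  qed
  show ?l if ?r
    unfolding span_code_def mem_Collect_eq
  proof (intro exI[of _ v] ext)
    fix j show "v j = (if j < N then (\<Sum>i<k. v i * G i j) else 0)"
      using \<open>?r\<close> unit[of j v] by (cases "j < k") (auto simp: vecs_def)
  qed
qed

lemma mem_dual_span_code: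
  "v \<in> dual_code N (span_code k N G) \<longleftrightarrow> v \<in> vecs N \<and> (\<forall>i<k. (\<Sum>j<N. G i j * v j) = 0)"
    (is "?l \<longleftrightarrow> ?r")
proof
  show ?r if ?l
  proof (intro conjI allI impI)
    show "v \<in> vecs N" using \<open>?l\<close> by (simp add: dual_code_def)
    fix i assume "i < k"
    have "(\<lambda>j. if j < N then G i j else 0) \<in> span_code k N G"
      unfolding span_code_def mem_Collect_eq
      by (intro exI[of _ "\<lambda>l. if l = i then 1 else 0"])
        (use \<open>i < k\<close> in \<open>simp add: if_distrib[where f = "\<lambda>x. x * _"] cong: if_cong\<close>)
    then show "(\<Sum>j<N. G i j * v j) = 0"
      using \<open>?l\<close> by (auto simp: dual_code_def mult.commute)
  qed
  show ?l if ?r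
  proof -
    have "(\<Sum>j<N. v j * (\<Sum>i<k. c i * G i j)) = 0" for c
    proof -
      have "(\<Sum>j<N. v j * (\<Sum>i<k. c i * G i j)) = (\<Sum>i<k. c i * (\<Sum>j<N. G i j * v j))"
        unfolding sum_distrib_left by (subst sum.swap) (simp add: mult_ac)
      with \<open>?r\<close> show ?thesis by simp
    qed
    with \<open>?r\<close> show ?l by (auto simp: dual_code_def span_code_def)
  qed
qed

lemma ev_ext_iff:
  assumes "card Z \<ge> n"
  shows "(\<forall>j<n. v j = w j) \<longleftrightarrow> (\<forall>z\<in>Z. ev n v z = ev n w z)"
  using ev_eq_imp_eq[OF assms] by (metis ev_cong)

lemma sum_lessThan_add:
  fixes f :: "nat \<Rightarrow> 'b::comm_monoid_add"
  shows "(\<Sum>j<m + n. f j) = (\<Sum>j<m. f j) + (\<Sum>j<n. f (m + j))"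
  by (induction n) (simp_all add: add.assoc)

lemma all_nat_interval_shift: "(\<forall>j\<in>{m..<m + n}. P j) \<longleftrightarrow> (\<forall>j<n. P (m + j))" for m n :: nat
  by (metis add_less_cancel_left atLeastLessThan_iff le_Suc_ex le_add1)

lemma all_less_add: "(\<forall>j<m + n. P j) \<longleftrightarrow> (\<forall>j<m. P j) \<and> (\<forall>j<n. P (m + j))" for m n :: nat
  by (metis add_less_cancel_left le_Suc_ex not_less trans_less_add1)

context
  fixes n :: nat and Z :: "'a::{finite,field} alg_closure set"
  assumes n: "n > 0"
  defines "Z \<equiv> {z. z ^ n = -1}"
  assumes card_Z: "card Z = n"
begin

lemmas ev_iff = ev_ext_iff[of n Z, OF eq_refl[OF card_Z[symmetric]]]

lemma Z_D: "z \<in> Z \<Longrightarrow> z ^ n = -1"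
  by (simp add: Z_def)

lemma mem_code_h_iff:
  "v \<in> code_h n h \<longleftrightarrow>
     v \<in> vecs (2 * n) \<and> (\<forall>z\<in>Z. ev n (\<lambda>j. v (n + j)) z = ev n v z * ev n h z)"
proof -
  have "v \<in> code_h n h \<longleftrightarrow> v \<in> vecs (2 * n) \<and>
          (\<forall>j\<in>{n..<n + n}. v j = (\<Sum>i<n. v i * gen_h n h i j))"
    unfolding code_h_def by (subst mem_span_code_systematic) (auto simp: gen_h_def mult_2)
  also have "(\<forall>j\<in>{n..<n + n}. v j = (\<Sum>i<n. v i * gen_h n h i j)) \<longleftrightarrow>
               (\<forall>j<n. v (n + j) = (\<Sum>i<n. v i * negacirc n h i j))"
    unfolding all_nat_interval_shift by (simp add: gen_h_def)
  also have "\<dots> \<longleftrightarrow> (\<forall>z\<in>Z. ev n (\<lambda>j. v (n + j)) z = ev n v z * ev n h z)"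
    unfolding ev_iff by (simp add: ev_vec_negacirc Z_D)
  finally show ?thesis .
qed

lemma mem_dual_code_h_iff:
  "v \<in> dual_code (2 * n) (code_h n h) \<longleftrightarrow>
     v \<in> vecs (2 * n) \<and> (\<forall>z\<in>Z. ev n v z = - (ev n (\<lambda>j. v (n + j)) z * ev n h (inverse z)))"
proof -
  have "v \<in> dual_code (2 * n) (code_h n h) \<longleftrightarrow> v \<in> vecs (2 * n) \<and>
          (\<forall>i<n. (\<Sum>j<n + n. gen_h n h i j * v j) = 0)"
    unfolding code_h_def mem_dual_span_code by (simp add: mult_2)
  also have "(\<forall>i<n. (\<Sum>j<n + n. gen_h n h i j * v j) = 0) \<longleftrightarrow>
               (\<forall>i<n. v i = - (\<Sum>j<n. negacirc n h i j * v (n + j)))"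
    unfolding sum_lessThan_add
    by (simp add: gen_h_def if_distrib[where f = "\<lambda>x. x * _"] eq_neg_iff_add_eq_0 cong: if_cong)
  also have "\<dots> \<longleftrightarrow> (\<forall>z\<in>Z. ev n v z = - (ev n (\<lambda>j. v (n + j)) z * ev n h (inverse z)))"
    unfolding ev_iff by (simp add: ev_negacirc_vec ev_uminus Z_D)
  finally show ?thesis .
qed

lemma self_dual_code_h_iff:
  "self_dual (2 * n) (code_h n h) \<longleftrightarrow> (\<forall>z\<in>Z. ev n h z * ev n h (inverse z) = -1)"
proof
  assume sd: "self_dual (2 * n) (code_h n h)"
  define v where "v = (\<lambda>j. if j < n then (if j = 0 then 1 else 0) else if j < 2 * n then h (j - n) else 0)"
  have 1: "ev n v z = 1" for z
    using ev_cong[of n v "\<lambda>j. if j = 0 then 1 else 0" z] ev_unit[OF n] by (simp add: v_def)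
  have 2: "ev n (\<lambda>j. v (n + j)) z = ev n h z" for z
    by (rule ev_cong) (simp add: v_def)
  have "v \<in> code_h n h"
    unfolding mem_code_h_iff by (auto simp: 1 2) (simp add: v_def vecs_def)
  then have "v \<in> dual_code (2 * n) (code_h n h)"
    using sd by (simp add: self_dual_def)
  then show "\<forall>z\<in>Z. ev n h z * ev n h (inverse z) = -1"
    unfolding mem_dual_code_h_iff 1 2 by (metis add.inverse_inverse mult.commute)
next
  assume *: "\<forall>z\<in>Z. ev n h z * ev n h (inverse z) = -1"
  have "w = u * c \<longleftrightarrow> u = - (w * d)" if "c * d = -1" for u w c d :: "'a alg_closure"
  proof
    show "u = - (w * d)" if "w = u * c" using \<open>c * d = -1\<close> that by (simp add: mult.assoc)
    have "d * c = -1" using \<open>c * d = -1\<close> by (simp add: mult.commute)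
    then show "w = u * c" if "u = - (w * d)" using that by (simp add: mult.assoc)
  qed
  with * show "self_dual (2 * n) (code_h n h)"
    unfolding self_dual_def set_eq_iff mem_code_h_iff mem_dual_code_h_iff by blast
qed

lemma gen_ab_blocks:
  assumes "i < n" "j < n"
  shows "gen_ab n a b i (2 * n + j) = negacirc n a i j"
    and "gen_ab n a b i (3 * n + j) = negacirc n b i j"
    and "gen_ab n a b (n + i) (2 * n + j) = - negacirc n b j i"
    and "gen_ab n a b (n + i) (3 * n + j) = negacirc n a j i"
  using assms by (simp_all add: gen_ab_def)

lemma gen_ab_systematic:
  "i < 2 * n \<Longrightarrow> j < 2 * n \<Longrightarrow> gen_ab n a b i j = (if i = j then 1 else 0)"
  by (auto simp: gen_ab_def)

lemma mem_code_ab_iff: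
  "v \<in> code_ab n a b \<longleftrightarrow> v \<in> vecs (4 * n) \<and> (\<forall>z\<in>Z.
     ev n (\<lambda>j. v (2 * n + j)) z = ev n v z * ev n a z - ev n (\<lambda>j. v (n + j)) z * ev n b (inverse z) \<and>
     ev n (\<lambda>j. v (3 * n + j)) z = ev n v z * ev n b z + ev n (\<lambda>j. v (n + j)) z * ev n a (inverse z))"
    (is "_ \<longleftrightarrow> _ \<and> ?R")
proof -
  have split: "(\<Sum>i<2 * n. f i) = (\<Sum>i<n. f i) + (\<Sum>i<n. f (n + i))" for f :: "nat \<Rightarrow> 'a"
    unfolding mult_2 by (rule sum_lessThan_add)
  have cols: "(\<Sum>i<2 * n. v i * gen_ab n a b i (2 * n + j)) =
               (\<Sum>i<n. v i * negacirc n a i j) - (\<Sum>i<n. negacirc n b j i * v (n + i))"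
             "(\<Sum>i<2 * n. v i * gen_ab n a b i (3 * n + j)) =
               (\<Sum>i<n. v i * negacirc n b i j) + (\<Sum>i<n. negacirc n a j i * v (n + i))"
    if "j < n" for j
    unfolding split using that by (simp_all add: gen_ab_blocks sum_negf mult.commute[of "v _"])
  have "v \<in> code_ab n a b \<longleftrightarrow> v \<in> vecs (4 * n) \<and>
          (\<forall>j\<in>{2 * n..<4 * n}. v j = (\<Sum>i<2 * n. v i * gen_ab n a b i j))"
    unfolding code_ab_def by (subst mem_span_code_systematic) (auto simp: gen_ab_systematic)
  also have "{2 * n..<4 * n} = {2 * n..<2 * n + n} \<union> {3 * n..<3 * n + n}" by auto
  also have "(\<forall>j\<in>\<dots>. v j = (\<Sum>i<2 * n. v i * gen_ab n a b i j)) \<longleftrightarrow>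
      (\<forall>j<n. v (2 * n + j) = (\<Sum>i<n. v i * negacirc n a i j) - (\<Sum>i<n. negacirc n b j i * v (n + i))) \<and>
      (\<forall>j<n. v (3 * n + j) = (\<Sum>i<n. v i * negacirc n b i j) + (\<Sum>i<n. negacirc n a j i * v (n + i)))"
    unfolding ball_Un all_nat_interval_shift by (simp add: cols)
  also have "\<dots> \<longleftrightarrow> ?R"
    unfolding ev_iff by (auto simp: ev_negacirc_vec ev_vec_negacirc ev_diff ev_add Z_D)
  finally show ?thesis .
qed

lemma mem_dual_code_ab_iff:
  "v \<in> dual_code (4 * n) (code_ab n a b) \<longleftrightarrow> v \<in> vecs (4 * n) \<and> (\<forall>z\<in>Z.
     ev n v z = - (ev n (\<lambda>j. v (2 * n + j)) z * ev n a (inverse z)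
       + ev n (\<lambda>j. v (3 * n + j)) z * ev n b (inverse z)) \<and>
     ev n (\<lambda>j. v (n + j)) z = ev n (\<lambda>j. v (2 * n + j)) z * ev n b z
       - ev n (\<lambda>j. v (3 * n + j)) z * ev n a z)"
    (is "_ \<longleftrightarrow> _ \<and> ?R")
proof -
  have "4 * n = 2 * n + (n + n)" by simp
  then have split: "(\<Sum>j<4 * n. f j) = (\<Sum>j<2 * n. f j) + ((\<Sum>j<n. f (2 * n + j)) + (\<Sum>j<n. f (3 * n + j)))"
    for f :: "nat \<Rightarrow> 'a"
    by (simp only: sum_lessThan_add) (simp add: algebra_simps)
  have sys: "(\<Sum>j<2 * n. gen_ab n a b i j * v j) = v i" if "i < 2 * n" for i
    using that by (simp add: gen_ab_systematic if_distrib[where f = "\<lambda>x. x * _"] cong: if_cong)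
  have rows: "(\<Sum>j<4 * n. gen_ab n a b i j * v j) = v i +
      ((\<Sum>j<n. negacirc n a i j * v (2 * n + j)) + (\<Sum>j<n. negacirc n b i j * v (3 * n + j)))"
    "(\<Sum>j<4 * n. gen_ab n a b (n + i) j * v j) = v (n + i) -
      ((\<Sum>j<n. v (2 * n + j) * negacirc n b j i) - (\<Sum>j<n. v (3 * n + j) * negacirc n a j i))"
    if "i < n" for i
    unfolding split using that by (simp_all add: sys gen_ab_blocks sum_negf mult.commute[of "v _"])
  have "v \<in> dual_code (4 * n) (code_ab n a b) \<longleftrightarrow> v \<in> vecs (4 * n) \<and>
          (\<forall>i<n + n. (\<Sum>j<4 * n. gen_ab n a b i j * v j) = 0)"
    unfolding code_ab_def mem_dual_span_code by (simp add: mult_2)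
  also have "(\<forall>i<n + n. (\<Sum>j<4 * n. gen_ab n a b i j * v j) = 0) \<longleftrightarrow>
      (\<forall>i<n. v i = - ((\<Sum>j<n. negacirc n a i j * v (2 * n + j)) + (\<Sum>j<n. negacirc n b i j * v (3 * n + j)))) \<and>
      (\<forall>i<n. v (n + i) = (\<Sum>j<n. v (2 * n + j) * negacirc n b j i) - (\<Sum>j<n. v (3 * n + j) * negacirc n a j i))"
    unfolding all_less_add by (simp add: rows add_eq_0_iff2)
  also have "\<dots> \<longleftrightarrow> ?R"
    unfolding ev_iff by (auto simp: ev_negacirc_vec ev_vec_negacirc ev_diff ev_add ev_uminus Z_D)
  finally show ?thesis .
qed

lemma self_dual_code_ab_iff:
  "self_dual (4 * n) (code_ab n a b) \<longleftrightarrow>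
     (\<forall>z\<in>Z. ev n a z * ev n a (inverse z) + ev n b z * ev n b (inverse z) = -1)"
proof
  assume sd: "self_dual (4 * n) (code_ab n a b)"
  define v where "v = (\<lambda>j. if j < n then (if j = 0 then 1 else 0) else if j < 2 * n then 0
    else if j < 3 * n then a (j - 2 * n) else if j < 4 * n then b (j - 3 * n) else 0)"
  have 1: "ev n v z = 1" for z
    using ev_cong[of n v "\<lambda>j. if j = 0 then 1 else 0" z] ev_unit[OF n] by (simp add: v_def)
  have 2: "ev n (\<lambda>j. v (n + j)) z = 0" for z
    by (subst ev_zero[of n z, symmetric], rule ev_cong) (simp add: v_def)
  have 3: "ev n (\<lambda>j. v (2 * n + j)) z = ev n a z" for z
    by (rule ev_cong) (simp add: v_def)
  have 4: "ev n (\<lambda>j. v (3 * n + j)) z = ev n b z" for z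
    by (rule ev_cong) (simp add: v_def)
  have "v \<in> code_ab n a b"
    unfolding mem_code_ab_iff by (auto simp: 1 2 3 4) (simp add: v_def vecs_def)
  then have "v \<in> dual_code (4 * n) (code_ab n a b)"
    using sd by (simp add: self_dual_def)
  then show "\<forall>z\<in>Z. ev n a z * ev n a (inverse z) + ev n b z * ev n b (inverse z) = -1"
    unfolding mem_dual_code_ab_iff 1 2 3 4 by (metis add.inverse_inverse)
next
  assume *: "\<forall>z\<in>Z. ev n a z * ev n a (inverse z) + ev n b z * ev n b (inverse z) = -1"
  have key: "w1 = u1 * a - u2 * b' \<and> w2 = u1 * b + u2 * a' \<longleftrightarrow>
        u1 = - (w1 * a' + w2 * b') \<and> u2 = w1 * b - w2 * a"
    if "a * a' + b * b' = -1" for u1 u2 w1 w2 a a' b b' :: "'a alg_closure"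
  proof -
    have e: "- ((u1 * a - u2 * b') * a' + (u1 * b + u2 * a') * b') = - (u1 * (a * a' + b * b'))"
      "(u1 * a - u2 * b') * b - (u1 * b + u2 * a') * a = - (u2 * (a * a' + b * b'))"
      "- (w1 * a' + w2 * b') * a - (w1 * b - w2 * a) * b' = - (w1 * (a * a' + b * b'))"
      "- (w1 * a' + w2 * b') * b + (w1 * b - w2 * a) * a' = - (w2 * (a * a' + b * b'))"
      by (simp_all add: algebra_simps)
    show ?thesis
    proof (intro iffI conjI; elim conjE)
      assume *: "w1 = u1 * a - u2 * b'" "w2 = u1 * b + u2 * a'"
      show "u1 = - (w1 * a' + w2 * b')" unfolding * e that by simp
      show "u2 = w1 * b - w2 * a" unfolding * e that by simp
    next
      assume *: "u1 = - (w1 * a' + w2 * b')" "u2 = w1 * b - w2 * a"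
      show "w1 = u1 * a - u2 * b'" unfolding * e that by simp
      show "w2 = u1 * b + u2 * a'" unfolding * e that by simp
    qed
  qed
  show "self_dual (4 * n) (code_ab n a b)"
    unfolding self_dual_def set_eq_iff mem_code_ab_iff mem_dual_code_ab_iff
    by (intro allI conj_cong ball_cong refl key) (use * in blast)
qed

end

section \<open>Frobenius orbits of roots\<close>

lemma power_eq_1_coprime:
  fixes w :: "'b::field"
  assumes "w ^ a = 1" "w ^ b = 1" "coprime a b"
  shows "w = 1"
proof (cases "a = 0")
  case False
  then obtain x y where "a * x = b * y + 1"
    using bezout_nat[of a b] assms(3) by auto
  then have "w ^ (a * x) = w ^ (b * y) * w" by (simp add: power_add)
  then show ?thesis by (simp add: power_mult assms(1,2))
qed (use assms in auto)

lemma order_dvd_of_power_eq_1: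
  fixes z :: "'b::field"
  assumes p: "prime p" "odd p" and z: "z ^ (2 * p) = -1" "z\<^sup>2 \<noteq> -1" and two: "(-1 :: 'b) \<noteq> 1"
    and m: "z ^ m = 1"
  shows "4 * p dvd m"
proof -
  have neg1: "even r" if "(-1 :: 'b) ^ r = 1" for r
    using that two by (cases "even r") auto
  have "(-1) ^ m = (z ^ m) ^ (2 * p)" unfolding z(1)[symmetric] by (simp only: power_mult[symmetric] mult_ac)
  then have "even m" using m by (intro neg1) simp
  then obtain r where r: "m = 2 * r" by blast
  have "(-1) ^ r = (z ^ m) ^ p" unfolding z(1)[symmetric] r by (simp only: power_mult[symmetric] mult_ac)
  then have "even r" using m by (intro neg1) simp
  then obtain t where t: "m = 4 * t" using r by fastforce
  have "p dvd t"
  proof (rule ccontr)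
    assume "\<not> p dvd t"
    then have "coprime p t" using p(1) by (simp add: prime_imp_coprime)
    moreover have "(z ^ 4) ^ p = (z ^ (2 * p)) ^ 2" by (simp flip: power_mult)
    then have "(z ^ 4) ^ p = 1" using z(1) by simp
    moreover have "(z ^ 4) ^ t = 1" using m t by (simp add: power_mult)
    ultimately have "z ^ 4 = 1" by (metis power_eq_1_coprime)
    then have "(z\<^sup>2)\<^sup>2 = 1" by (simp only: power_mult[symmetric]) simp
    then have "z\<^sup>2 = 1" unfolding power2_eq_1_iff[of "z\<^sup>2"] using z(2) by blast
    then have "z ^ (2 * p) = 1" by (simp add: power_mult)
    with z(1) two show False by simp
  qed
  then show ?thesis by (simp add: t)
qed

lemma pow_cong_minus_1:
  fixes p q :: nat
  assumes "prime p" "p mod 4 = 3" "q mod 4 = 3" "ord (4 * p) q = p - 1" "ord p q mod 4 = 2"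
  shows "4 * p dvd q ^ ((p - 1) div 2) + 1"
proof -
  define k where "k = (p - 1) div 2"
  have k: "p - 1 = 2 * k" "odd k" using assms(2) unfolding k_def by presburger+
  have q: "q > 0" using assms(3) by (cases q) auto
  have "[q ^ (2 * k) = 1] (mod 4 * p)" using ord[of q "4 * p"] assms(4) k(1) by simp
  then have "[q ^ (2 * k) = 1] (mod p)" by (rule cong_dvd_modulus_nat) simp
  then have "p dvd q ^ (2 * k) - 1" by (rule cong_to_1_nat)
  also have "q ^ (2 * k) - 1 = (q ^ k - 1) * (q ^ k + 1)"
    by (simp only: mult_2 power_add) (simp add: algebra_simps diff_mult_distrib)
  finally have "p dvd q ^ k - 1 \<or> p dvd q ^ k + 1"
    using assms(1) prime_dvd_mult_iff by blast
  moreover have "\<not> p dvd q ^ k - 1"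
  proof
    assume "p dvd q ^ k - 1"
    then have "[q ^ k = 1] (mod p)" using q by (simp add: cong_altdef_nat)
    then have "ord p q dvd k" unfolding ord_divides .
    moreover have "even (ord p q)" using assms(5) by presburger
    ultimately show False using k(2) dvd_trans by blast
  qed
  ultimately have "p dvd q ^ k + 1" by blast
  moreover have "4 dvd q ^ k + 1"
  proof -
    obtain j where j: "k = 2 * j + 1" using k(2) by (elim oddE)
    have "q ^ 2 mod 4 = 1" by (subst power_mod[symmetric]) (simp add: assms(3))
    then have "[q ^ 2 = 1] (mod 4)" by (simp add: cong_def)
    then have "[(q ^ 2) ^ j * q = 1 ^ j * 3] (mod 4)"
      using assms(3) by (intro cong_mult cong_pow) (simp_all add: cong_def)
    then have "[q ^ k = 3] (mod 4)" unfolding j power_add power_mult by simp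
    then show ?thesis unfolding cong_def by presburger
  qed
  moreover have "coprime 4 p"
  proof -
    have "odd p" using assms(2) by presburger
    then have "coprime (2 ^ 2) p" unfolding coprime_power_left_iff by simp
    then show ?thesis by simp
  qed
  ultimately show ?thesis unfolding k_def by (simp add: divides_mult)
qed

text \<open>The roots of \<open>x ^ (2 * p) + 1\<close> form three Frobenius orbits, corresponding to the factors
  \<open>x\<^sup>2 + 1\<close>, \<open>g\<^sub>1\<close> and \<open>g\<^sub>2\<close>. The equations \<open>r ^ (CARD('a) ^ t + 1) = 1\<close> express
  that these factors are self-reciprocal: Frobenius powers invert the roots.\<close>

lemma root_orbits:
  fixes p :: nat
  assumes p: "prime p" "p mod 4 = 3"
    and q: "CARD('a::{finite,field}) mod 4 = 3" "coprime p CARD('a)"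
    and ords: "ord (4 * p) CARD('a) = p - 1" "ord p CARD('a) mod 4 = 2"
  defines "Z \<equiv> {z :: 'a alg_closure. z ^ (2 * p) = -1}"
  defines "k \<equiv> (p - 1) div 2"
  shows "card Z = 2 * p"
    and "\<exists>r1\<in>Z. \<exists>r2\<in>Z. \<exists>r3\<in>Z. r1 ^ (CARD('a) ^ 1 + 1) = 1 \<and> r2 ^ (CARD('a) ^ k + 1) = 1 \<and>
           r3 ^ (CARD('a) ^ k + 1) = 1 \<and> (\<forall>z\<in>Z. \<exists>r\<in>{r1, r2, r3}. \<exists>j. z = r ^ (CARD('a) ^ j))"
proof -
  let ?q = "CARD('a)"
  have p_gt: "p > 2" using p(2) by presburger
  have oddp: "odd p" using p(2) by presburger
  have oddq: "odd ?q" using q(1) by presburger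
  have k: "p - 1 = 2 * k" "odd k" using p(2) unfolding k_def by presburger+
  have nz: "of_nat (2 * p) \<noteq> (0 :: 'a alg_closure)"
  proof
    assume "of_nat (2 * p) = (0 :: 'a alg_closure)"
    then have "CHAR('a) dvd 2 * p" by (simp only: of_nat_eq_0_iff_char_dvd CHAR_alg_closure)
    moreover have "CHAR('a) dvd ?q" by (rule CHAR_dvd_CARD)
    moreover have "coprime (2 * p) ?q" using q(2) oddq by simp
    ultimately have "CHAR('a) dvd 1" by (metis coprime_common_divisor)
    then show False by simp
  qed
  then have two_nz: "of_nat 2 \<noteq> (0 :: 'a alg_closure)" by (metis of_nat_mult mult_zero_left)
  then have neg1: "(-1 :: 'a alg_closure) \<noteq> 1"
    by (metis add.right_inverse of_nat_numeral one_add_one)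
  have card_Z: "card Z = 2 * p" and fin_Z: "finite Z"
    unfolding Z_def using card_power_eq[OF nz, of "-1"] by simp_all

  show "card Z = 2 * p" by (rule card_Z)
  define I where "I = {z :: 'a alg_closure. z\<^sup>2 = -1}"
  have card_I: "card I = 2" and fin_I: "finite I"
    unfolding I_def using card_power_eq[OF two_nz, of "-1"] by simp_all
  have I_Z: "I \<subseteq> Z" using oddp by (auto simp: I_def Z_def power_mult)
  obtain i where i: "i \<in> I" using card_I by fastforce
  have i2: "i\<^sup>2 = -1" using i by (simp add: I_def)
  obtain l where l: "?q = 4 * l + 3" using q(1) by (metis mult.commute div_mult_mod_eq)
  have i4: "i ^ 4 = 1" using i2 by (metis power2_minus power_mult num_double numeral_times_numeral one_power2)
  have "?q ^ 1 + 1 = 4 * (l + 1)" by (simp add: l)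
  then have r1: "i ^ (?q ^ 1 + 1) = 1" by (simp only: power_mult i4 power_one)
  have "i * i ^ ?q = i * (- i)" using r1 i2 by (simp add: power2_eq_square)
  moreover have "i \<noteq> 0" using i2 by auto
  ultimately have iq: "i ^ ?q = - i" using mult_left_cancel by blast

  have copr: "coprime (4 * p) (?q ^ j)" for j
    using q(2) oddq coprime_power_left_iff[of 2 2 ?q] by auto
  have Q: "4 * p dvd ?q ^ k + 1"
    unfolding k_def using pow_cong_minus_1[OF p q(1) ords] .
  have inv: "z ^ (?q ^ k + 1) = 1" if "z \<in> Z" for z
  proof -
    obtain c where c: "?q ^ k + 1 = 4 * p * c" using Q by (elim dvdE)
    have "z ^ (?q ^ k + 1) = (z ^ (2 * p)) ^ (2 * c)"
      unfolding c power_mult[symmetric] by (simp add: mult_ac)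
    with that show ?thesis by (simp add: Z_def power_mult)
  qed
  have period1: "z ^ (?q ^ (2 * k)) = z" if "z \<in> Z" for z
  proof -
    have "z \<noteq> 0" using that p_gt by (auto simp: Z_def power_0_left)
    moreover have "(z ^ (?q ^ k) * z) ^ (?q ^ k) = z ^ (?q ^ k) * z"
      using inv[OF that] by (simp add: mult.commute)
    ultimately show ?thesis
      unfolding mult_2 power_add by (simp add: power_mult_distrib power_mult[symmetric])
  qed
  have period: "z ^ (?q ^ (2 * k * d)) = z" if "z \<in> Z" for z d
    using period1[OF that] by (induction d) (simp_all add: power_add power_mult)
  have Z_frob: "z ^ (?q ^ j) \<in> Z" if "z \<in> Z" for z j
  proof -
    have "(z ^ (?q ^ j)) ^ (2 * p) = (z ^ (2 * p)) ^ (?q ^ j)"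
      by (simp add: power_mult[symmetric] mult_ac)
    with that oddq show ?thesis by (simp add: Z_def)
  qed

  define orb where "orb z = range (\<lambda>j. z ^ (?q ^ j))" for z :: "'a alg_closure"
  have orb_mem: "z \<in> orb z" for z
    unfolding orb_def by (rule range_eqI[of _ _ 0]) simp
  have orb_Z: "orb z \<subseteq> Z" if "z \<in> Z" for z
    using Z_frob[OF that] by (auto simp: orb_def)
  have orb_trans: "x \<in> orb y" if "x \<in> orb z" "z \<in> orb y" for x y z
  proof -
    from that obtain j j' where "x = z ^ (?q ^ j)" "z = y ^ (?q ^ j')" by (auto simp: orb_def)
    then have "x = y ^ (?q ^ (j' + j))" by (simp add: power_mult power_add)
    then show ?thesis by (auto simp: orb_def)
  qed
  have orb_sym: "z \<in> orb x" if "x \<in> orb z" "z \<in> Z" for x z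
  proof -
    from that(1) obtain j where j: "x = z ^ (?q ^ j)" by (auto simp: orb_def)
    have "j \<le> 2 * k * j" using k p_gt by (cases k) auto
    then have "z ^ (?q ^ (2 * k * j)) = x ^ (?q ^ (2 * k * j - j))"
      unfolding j by (simp add: power_mult[symmetric] power_add[symmetric])
    then have "z = x ^ (?q ^ (2 * k * j - j))" using period[OF that(2)] by simp
    then show ?thesis by (auto simp: orb_def)
  qed
  have orb_I: "z \<in> I" if "z \<in> orb x" "x \<in> I" for x z
  proof -
    from that(1) obtain j where j: "z = x ^ (?q ^ j)" by (auto simp: orb_def)
    have "z\<^sup>2 = (x\<^sup>2) ^ (?q ^ j)" unfolding j by (simp add: power_mult[symmetric] mult.commute)
    then show ?thesis using that(2) oddq by (simp add: I_def)
  qed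
  have I_orb: "I = orb i"
  proof
    show "I \<subseteq> orb i"
    proof
      fix z assume "z \<in> I"
      then have "z\<^sup>2 = i\<^sup>2" using i2 by (simp add: I_def)
      then have "z = i ^ (?q ^ 0) \<or> z = i ^ (?q ^ 1)" by (simp add: iq power2_eq_iff)
      then show "z \<in> orb i" unfolding orb_def by blast
    qed
  qed (use orb_I i in blast)
  have card_orb: "card (orb z) = 2 * k" if "z \<in> Z" "z \<notin> I" for z
  proof -
    have "orb z = (\<lambda>j. z ^ (?q ^ j)) ` {..<2 * k}"
    proof
      show "orb z \<subseteq> (\<lambda>j. z ^ (?q ^ j)) ` {..<2 * k}"
      proof
        fix x assume "x \<in> orb z"
        then obtain j where x: "x = z ^ (?q ^ j)" by (auto simp: orb_def)
        have e: "?q ^ j = ?q ^ (2 * k * (j div (2 * k))) * ?q ^ (j mod (2 * k))"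
          by (simp add: power_add[symmetric])
        have "x = (z ^ (?q ^ (2 * k * (j div (2 * k))))) ^ (?q ^ (j mod (2 * k)))"
          unfolding x by (subst e) (rule power_mult)
        then have "x = z ^ (?q ^ (j mod (2 * k)))" unfolding period[OF that(1)] .
        moreover have "j mod (2 * k) < 2 * k" using k p_gt by (intro mod_less_divisor) auto
        ultimately show "x \<in> (\<lambda>j. z ^ (?q ^ j)) ` {..<2 * k}" by blast
      qed
    qed (auto simp: orb_def)
    moreover have "inj_on (\<lambda>j. z ^ (?q ^ j)) {..<2 * k}"
    proof (rule linorder_inj_onI)
      fix a b assume ab: "a < b" "a \<in> {..<2 * k}" "b \<in> {..<2 * k}"
      show "z ^ (?q ^ a) \<noteq> z ^ (?q ^ b)"
      proof
        assume eq: "z ^ (?q ^ a) = z ^ (?q ^ b)"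
        have "?q ^ b = ?q ^ a * ?q ^ (b - a)" using ab by (simp add: power_add[symmetric])
        also have "\<dots> = ?q ^ a * (?q ^ (b - a) - 1) + ?q ^ a" by (simp add: algebra_simps)
        finally have "z ^ (?q ^ a * (?q ^ (b - a) - 1)) * z ^ (?q ^ a) = z ^ (?q ^ a)"
          using eq by (simp add: power_add)
        moreover have "z \<noteq> 0" using that p_gt by (auto simp: Z_def power_0_left)
        ultimately have "z ^ (?q ^ a * (?q ^ (b - a) - 1)) = 1" by simp
        then have "4 * p dvd ?q ^ a * (?q ^ (b - a) - 1)"
          using order_dvd_of_power_eq_1[OF p(1) oddp _ _ neg1] that by (simp add: Z_def I_def)
        then have "4 * p dvd ?q ^ (b - a) - 1"
          using copr by (simp add: coprime_dvd_mult_right_iff)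
        then have "[?q ^ (b - a) = 1] (mod 4 * p)" by (simp add: cong_altdef_nat)
        then have "p - 1 dvd b - a" unfolding ord_divides ords(1) .
        then show False using ab k(1) by (auto dest: dvd_imp_le)
      qed
    qed auto
    ultimately show ?thesis by (simp add: card_image)
  qed
  have "card I < card Z" using card_Z card_I p_gt by simp
  then obtain z1 where z1: "z1 \<in> Z" "z1 \<notin> I"
    by (meson card_mono fin_I leD subsetI)
  have fin_orb: "finite (orb z)" if "z \<in> Z" for z
    using orb_Z[OF that] fin_Z finite_subset by blast
  have dis1: "I \<inter> orb z = {}" if "z \<in> Z" "z \<notin> I" for z
    using orb_sym[OF _ that(1)] orb_I that(2) by blast
  have card1: "card (I \<union> orb z1) = 2 + 2 * k"
    using z1 by (simp add: card_Un_disjoint fin_I fin_orb dis1 card_I card_orb)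
  then have "card (I \<union> orb z1) < card Z" using card_Z k p_gt by linarith
  then obtain z2 where z2: "z2 \<in> Z" "z2 \<notin> I" "z2 \<notin> orb z1"
    by (metis UnCI card_mono fin_I fin_orb finite_UnI leD subsetI z1(1))
  have "(I \<union> orb z1) \<inter> orb z2 = {}"
    using dis1[OF z2(1,2)] orb_sym[OF _ z2(1)] orb_trans z2(3) by blast
  then have "card (I \<union> orb z1 \<union> orb z2) = 2 * p"
    using z1 z2 k p_gt by (simp add: card_Un_disjoint fin_I fin_orb card1 card_orb)
  then have "I \<union> orb z1 \<union> orb z2 = Z"
    using card_Z fin_Z I_Z orb_Z[OF z1(1)] orb_Z[OF z2(1)] by (intro card_subset_eq) auto
  then have "\<forall>z\<in>Z. \<exists>r\<in>{i, z1, z2}. z \<in> orb r" using I_orb by blast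
  then have "\<forall>z\<in>Z. \<exists>r\<in>{i, z1, z2}. \<exists>j. z = r ^ (?q ^ j)" by (simp add: orb_def image_iff)
  then show "\<exists>r1\<in>Z. \<exists>r2\<in>Z. \<exists>r3\<in>Z. r1 ^ (?q ^ 1 + 1) = 1 \<and> r2 ^ (?q ^ k + 1) = 1 \<and>
           r3 ^ (?q ^ k + 1) = 1 \<and> (\<forall>z\<in>Z. \<exists>r\<in>{r1, r2, r3}. \<exists>j. z = r ^ (?q ^ j))"
    using r1 inv z1(1) z2(1) i I_Z by (meson subsetD)
qed

section \<open>Counting\<close>

lemma card_filter_bij_betw:
  assumes "bij_betw f A B"
  shows "card {x \<in> A. P (f x)} = card {y \<in> B. P y}"
proof -
  have "bij_betw f {x \<in> A. P (f x)} {y \<in> B. P y}"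
    using assms by (auto simp: bij_betw_def inj_on_def)
  then show ?thesis by (rule bij_betw_same_card)
qed

lemma card_regroup:
  "card {z \<in> (A \<times> B \<times> C) \<times> (A \<times> B \<times> C).
      (\<lambda>((x1, x2, x3), (y1, y2, y3)). P x1 y1 \<and> Q x2 y2 \<and> R x3 y3) z}
   = card {(x, y) \<in> A \<times> A. P x y} * (card {(x, y) \<in> B \<times> B. Q x y} * card {(x, y) \<in> C \<times> C. R x y})"
  unfolding card_cartesian_product[symmetric]
  by (rule bij_betw_same_card[where f = "\<lambda>((x1, x2, x3), (y1, y2, y3)). ((x1, y1), (x2, y2), (x3, y3))"],
      rule bij_betw_byWitness[where f' = "\<lambda>((x1, y1), (x2, y2), (x3, y3)). ((x1, x2, x3), (y1, y2, y3))"])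
    auto

lemma ev_inverse_root:
  fixes v :: "nat \<Rightarrow> 'a::{finite,field}"
  assumes "r ^ (CARD('a) ^ t + 1) = 1"
  shows "ev n v (inverse r) = ev n v r ^ (CARD('a) ^ t)"
proof -
  have "inverse r = r ^ (CARD('a) ^ t)"
    using assms by (intro inverse_unique) simp
  then show ?thesis by (simp add: ev_frobenius)
qed

lemma ev_in_fixed_field:
  fixes v :: "nat \<Rightarrow> 'a::{finite,field}"
  assumes "r ^ (CARD('a) ^ t + 1) = 1"
  shows "ev n v r \<in> fixed_field (2 * t)"
proof -
  have "ev n v r ^ (CARD('a) ^ (2 * t)) = (ev n v r ^ (CARD('a) ^ t)) ^ (CARD('a) ^ t)"
    by (simp only: mult_2 power_add power_mult)
  also have "\<dots> = ev n v (inverse r) ^ (CARD('a) ^ t)"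
    by (simp only: ev_inverse_root[OF assms])
  also have "\<dots> = ev n v (inverse (inverse r))"
    using assms by (intro ev_inverse_root[symmetric]) (simp only: power_inverse inverse_1)
  finally show ?thesis by (simp add: fixed_field_def)
qed

context
  fixes p :: nat
  assumes p: "prime p" "p mod 4 = 3"
    and q: "CARD('a::{finite,field}) mod 4 = 3" "coprime p CARD('a)"
    and ords: "ord (4 * p) CARD('a) = p - 1" "ord p CARD('a) mod 4 = 2"
begin

private abbreviation (input) "k \<equiv> (p - 1) div 2"
private abbreviation (input) "K1 \<equiv> fixed_field (2 * 1) :: 'a alg_closure set"
private abbreviation (input) "K2 \<equiv> fixed_field (2 * k) :: 'a alg_closure set"
private abbreviation (input) "N1 \<equiv> \<lambda>x :: 'a alg_closure. x ^ (CARD('a) ^ 1 + 1)"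
private abbreviation (input) "N2 \<equiv> \<lambda>x :: 'a alg_closure. x ^ (CARD('a) ^ k + 1)"

text \<open>The Chinese remainder isomorphism, turning the involution \<open>a'\<close> into the conjugation of each
  of the three fields.\<close>

lemma evaluation_bij:
  obtains f :: "(nat \<Rightarrow> 'a) \<Rightarrow> 'a alg_closure \<times> 'a alg_closure \<times> 'a alg_closure"
  where "bij_betw f (vecs (2 * p)) (K1 \<times> K2 \<times> K2)"
    and "\<And>a b. (\<forall>z\<in>{z. z ^ (2 * p) = -1}. ev (2 * p) a z * ev (2 * p) a (inverse z)
                 + ev (2 * p) b z * ev (2 * p) b (inverse z) = -1) \<longleftrightarrow>
          (case (f a, f b) of ((x1, x2, x3), (y1, y2, y3)) \<Rightarrow>
             N1 x1 + N1 y1 = -1 \<and> N2 x2 + N2 y2 = -1 \<and> N2 x3 + N2 y3 = -1)"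
    and "f (\<lambda>j. 0) = (0, 0, 0)"
proof -
  let ?q = "CARD('a)"
  let ?n = "2 * p"
  define Z where "Z = {z :: 'a alg_closure. z ^ ?n = -1}"
  have card_Z: "card Z = ?n" unfolding Z_def by (rule root_orbits[OF p q ords])
  from root_orbits(2)[OF p q ords] obtain r1 r2 r3 where rZ: "{r1, r2, r3} \<subseteq> Z"
    and r1: "r1 ^ (?q ^ 1 + 1) = 1" and r2: "r2 ^ (?q ^ k + 1) = 1" and r3: "r3 ^ (?q ^ k + 1) = 1"
    and orbits: "\<And>z. z \<in> Z \<Longrightarrow> \<exists>r\<in>{r1, r2, r3}. \<exists>j. z = r ^ (?q ^ j)"
    unfolding Z_def[symmetric] by blast
  have oddq: "odd ?q" using q(1) by presburger
  have k: "k > 0" "2 * k = p - 1" using p(2) by presburger+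
  define f where "f v = (ev ?n v r1, ev ?n v r2, ev ?n v r3)" for v :: "nat \<Rightarrow> 'a"
  have inj: "inj_on f (vecs ?n)"
  proof (rule inj_onI)
    fix v w :: "nat \<Rightarrow> 'a"
    assume v: "v \<in> vecs ?n" and w: "w \<in> vecs ?n" and eq: "f v = f w"
    have "ev ?n v z = ev ?n w z" if z: "z \<in> Z" for z
    proof -
      obtain r j where "r \<in> {r1, r2, r3}" "z = r ^ (?q ^ j)" using orbits[OF z] by blast
      moreover have "ev ?n v r = ev ?n w r" using eq calculation(1) by (auto simp: f_def)
      ultimately show ?thesis by (simp add: ev_frobenius[symmetric])
    qed
    then have "v j = w j" if "j < ?n" for j
      using ev_eq_imp_eq[of ?n Z v w j] card_Z that by simp
    then show "v = w" using v w by (auto simp: vecs_def fun_eq_iff) (metis not_le)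
  qed
  have "bij_betw f (vecs ?n) (K1 \<times> K2 \<times> K2)"
    unfolding bij_betw_def
  proof (intro conjI inj card_subset_eq)
    show "finite (K1 \<times> K2 \<times> K2)" using k by (intro finite_cartesian_product card_fixed_field) auto
    show "f ` vecs ?n \<subseteq> K1 \<times> K2 \<times> K2"
      unfolding f_def using ev_in_fixed_field[OF r1] ev_in_fixed_field[OF r2] ev_in_fixed_field[OF r3] by auto
    have "card (K1 \<times> K2 \<times> K2) = ?q ^ (2 * 1) * (?q ^ (2 * k) * ?q ^ (2 * k))"
      unfolding card_cartesian_product using k by (simp only: card_fixed_field)
    also have "\<dots> = ?q ^ (2 * 1 + (2 * k + 2 * k))" by (simp only: power_add)
    also have "2 * 1 + (2 * k + 2 * k) = ?n" using k by linarith
    also have "?q ^ ?n = card (f ` vecs ?n)"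
      by (simp only: card_image[OF inj] card_vecs)
    finally show "card (f ` vecs ?n) = card (K1 \<times> K2 \<times> K2)" by simp
  qed
  moreover have "(\<forall>z\<in>Z. ev ?n a z * ev ?n a (inverse z) + ev ?n b z * ev ?n b (inverse z) = -1) \<longleftrightarrow>
          (case (f a, f b) of ((x1, x2, x3), (y1, y2, y3)) \<Rightarrow>
             N1 x1 + N1 y1 = -1 \<and> N2 x2 + N2 y2 = -1 \<and> N2 x3 + N2 y3 = -1)" for a b
  proof -
    define G where "G z = ev ?n a z * ev ?n a (inverse z) + ev ?n b z * ev ?n b (inverse z)" for z
    have G: "G r = ev ?n a r ^ (?q ^ t + 1) + ev ?n b r ^ (?q ^ t + 1)"
      if "r ^ (?q ^ t + 1) = 1" for r t
      unfolding G_def ev_inverse_root[OF that] by simp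
    have "G (z ^ (?q ^ j)) = G z ^ (?q ^ j)" for z j
      unfolding G_def frobenius_add power_mult_distrib ev_frobenius power_inverse ..
    then have "G (r ^ (?q ^ j)) = -1" if "G r = -1" for r j
      using that oddq by simp
    then have "(\<forall>z\<in>Z. G z = -1) \<longleftrightarrow> G r1 = -1 \<and> G r2 = -1 \<and> G r3 = -1"
      using orbits rZ by blast
    also have "\<dots> \<longleftrightarrow> (case (f a, f b) of ((x1, x2, x3), (y1, y2, y3)) \<Rightarrow>
             N1 x1 + N1 y1 = -1 \<and> N2 x2 + N2 y2 = -1 \<and> N2 x3 + N2 y3 = -1)"
      unfolding G[OF r1] G[OF r2] G[OF r3] f_def by simp
    finally show ?thesis unfolding G_def .
  qed
  moreover have "f (\<lambda>j. 0) = (0, 0, 0)" by (simp add: f_def ev_zero)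
  ultimately show thesis using that[of f] unfolding Z_def by blast
qed

lemma card_self_dual_code_h:
  "card {h :: nat \<Rightarrow> 'a. h \<in> vecs (2 * p) \<and> self_dual (4 * p) (code_h (2 * p) h)}
     = (CARD('a) + 1) * (CARD('a) ^ k + 1) ^ 2"
proof -
  obtain f :: "(nat \<Rightarrow> 'a) \<Rightarrow> 'a alg_closure \<times> 'a alg_closure \<times> 'a alg_closure"
    where bij: "bij_betw f (vecs (2 * p)) (K1 \<times> K2 \<times> K2)"
      and cond: "\<And>a b. (\<forall>z\<in>{z. z ^ (2 * p) = -1}. ev (2 * p) a z * ev (2 * p) a (inverse z)
                 + ev (2 * p) b z * ev (2 * p) b (inverse z) = -1) \<longleftrightarrow>
          (case (f a, f b) of ((x1, x2, x3), (y1, y2, y3)) \<Rightarrow>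
             N1 x1 + N1 y1 = -1 \<and> N2 x2 + N2 y2 = -1 \<and> N2 x3 + N2 y3 = -1)"
      and f0: "f (\<lambda>j. 0) = (0, 0, 0)"
    by (rule evaluation_bij) blast
  have k: "k > 0" using p(2) by presburger
  have "odd CARD('a)" using q(1) by presburger
  then have neg: "-1 \<in> (fixed_field t :: 'a alg_closure set)" for t
    by (simp add: fixed_field_def)
  let ?P = "\<lambda>(x1, x2, x3). N1 x1 = -1 \<and> N2 x2 = -1 \<and> N2 x3 = -1"
  have "self_dual (4 * p) (code_h (2 * p) h) \<longleftrightarrow> ?P (f h)" for h :: "nat \<Rightarrow> 'a"
  proof -
    have "self_dual (2 * (2 * p)) (code_h (2 * p) h) \<longleftrightarrow>
        (\<forall>z\<in>{z. z ^ (2 * p) = -1}. ev (2 * p) h z * ev (2 * p) h (inverse z) = -1)"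
      using p(2) by (intro self_dual_code_h_iff root_orbits(1)[OF p q ords]) (auto intro: Nat.gr0I)
    then show ?thesis using cond[of h "\<lambda>j. 0"] by (simp add: ev_zero f0 case_prod_unfold)
  qed
  then have "card {h :: nat \<Rightarrow> 'a. h \<in> vecs (2 * p) \<and> self_dual (4 * p) (code_h (2 * p) h)}
      = card {h \<in> vecs (2 * p). ?P (f h)}" by simp
  also have "\<dots> = card {x \<in> K1 \<times> K2 \<times> K2. ?P x}" by (rule card_filter_bij_betw[OF bij])
  also have "{x \<in> K1 \<times> K2 \<times> K2. ?P x} =
      {x \<in> K1. N1 x = -1} \<times> {x \<in> K2. N2 x = -1} \<times> {x \<in> K2. N2 x = -1}" by auto
  also have "card \<dots> = (CARD('a) ^ 1 + 1) * ((CARD('a) ^ k + 1) * (CARD('a) ^ k + 1))"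
    unfolding card_cartesian_product using k neg by (subst (1 2 3) card_norm_eq) auto
  finally show ?thesis by (simp add: power2_eq_square)
qed

lemma card_self_dual_code_ab:
  "card {(a :: nat \<Rightarrow> 'a, b :: nat \<Rightarrow> 'a).
      a \<in> vecs (2 * p) \<and> b \<in> vecs (2 * p) \<and> self_dual (8 * p) (code_ab (2 * p) a b)}
   = (CARD('a) + 1) * (CARD('a) ^ 2 - CARD('a)) * (CARD('a) ^ k + 1) ^ 2
     * (CARD('a) ^ (p - 1) - CARD('a) ^ k) ^ 2"
proof -
  obtain f :: "(nat \<Rightarrow> 'a) \<Rightarrow> 'a alg_closure \<times> 'a alg_closure \<times> 'a alg_closure"
    where bij: "bij_betw f (vecs (2 * p)) (K1 \<times> K2 \<times> K2)"
      and cond: "\<And>a b. (\<forall>z\<in>{z. z ^ (2 * p) = -1}. ev (2 * p) a z * ev (2 * p) a (inverse z)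
                 + ev (2 * p) b z * ev (2 * p) b (inverse z) = -1) \<longleftrightarrow>
          (case (f a, f b) of ((x1, x2, x3), (y1, y2, y3)) \<Rightarrow>
             N1 x1 + N1 y1 = -1 \<and> N2 x2 + N2 y2 = -1 \<and> N2 x3 + N2 y3 = -1)"
    by (rule evaluation_bij) blast
  have k: "k > 0" "p - 1 = k * 2" using p(2) by presburger+
  have oddq: "odd CARD('a)" using q(1) by presburger
  define P where "P = (\<lambda>((x1, x2, x3), (y1, y2, y3)). N1 x1 + N1 y1 = -1 \<and> N2 x2 + N2 y2 = -1 \<and> N2 x3 + N2 y3 = -1)"
  let ?V = "vecs (2 * p) :: (nat \<Rightarrow> 'a) set"
  let ?T1 = "{(x, y) \<in> K1 \<times> K1. N1 x + N1 y = -1}"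
  let ?T2 = "{(x, y) \<in> K2 \<times> K2. N2 x + N2 y = -1}"
  have "self_dual (8 * p) (code_ab (2 * p) a b) \<longleftrightarrow> P (f a, f b)" for a b :: "nat \<Rightarrow> 'a"
  proof -
    have "self_dual (4 * (2 * p)) (code_ab (2 * p) a b) \<longleftrightarrow>
        (\<forall>z\<in>{z. z ^ (2 * p) = -1}. ev (2 * p) a z * ev (2 * p) a (inverse z)
           + ev (2 * p) b z * ev (2 * p) b (inverse z) = -1)"
      using p(2) by (intro self_dual_code_ab_iff root_orbits(1)[OF p q ords]) (auto intro: Nat.gr0I)
    then show ?thesis unfolding cond P_def by (simp add: case_prod_unfold)
  qed
  then have "{(a :: nat \<Rightarrow> 'a, b :: nat \<Rightarrow> 'a).
      a \<in> vecs (2 * p) \<and> b \<in> vecs (2 * p) \<and> self_dual (8 * p) (code_ab (2 * p) a b)}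
      = {ab \<in> ?V \<times> ?V. P (map_prod f f ab)}" by auto
  then have "card {(a :: nat \<Rightarrow> 'a, b :: nat \<Rightarrow> 'a).
      a \<in> vecs (2 * p) \<and> b \<in> vecs (2 * p) \<and> self_dual (8 * p) (code_ab (2 * p) a b)}
      = card {ab \<in> ?V \<times> ?V. P (map_prod f f ab)}" by (rule arg_cong)
  also have "\<dots> = card {x \<in> (K1 \<times> K2 \<times> K2) \<times> (K1 \<times> K2 \<times> K2). P x}"
    by (rule card_filter_bij_betw[OF bij_betw_map_prod[OF bij bij]])
  also have "\<dots> = card ?T1 * (card ?T2 * card ?T2)" unfolding P_def by (rule card_regroup)
  also have "\<dots> = ((CARD('a) ^ 1 + 1) * ((CARD('a) ^ 1) ^ 2 - CARD('a) ^ 1)) *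
      (((CARD('a) ^ k + 1) * ((CARD('a) ^ k) ^ 2 - CARD('a) ^ k)) *
       ((CARD('a) ^ k + 1) * ((CARD('a) ^ k) ^ 2 - CARD('a) ^ k)))"
    by (simp only: card_norm_add_norm_eq[OF k(1) oddq] card_norm_add_norm_eq[OF zero_less_one oddq])
  also have "(CARD('a) ^ k) ^ 2 = CARD('a) ^ (p - 1)" unfolding power_mult[symmetric] k(2)[symmetric] ..
  finally show ?thesis by (simp only: power2_eq_square power_one_right mult_ac)
qed

end

theorem theorem4p3:
  fixes p :: nat and F :: "'a::{finite,field} itself"
  assumes "prime p" and "p mod 4 = 3"
    and "CARD('a) mod 4 = 3"
    and "coprime p CARD('a)"
    and "ord (4 * p) CARD('a) = p - 1"
    and "ord p CARD('a) mod 4 = 2"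
  shows "card {h :: nat \<Rightarrow> 'a. h \<in> vecs (2 * p) \<and> self_dual (4 * p) (code_h (2 * p) h)}
           = (CARD('a) + 1) * (CARD('a) ^ ((p - 1) div 2) + 1) ^ 2
       \<and> card {(a :: nat \<Rightarrow> 'a, b :: nat \<Rightarrow> 'a).
                a \<in> vecs (2 * p) \<and> b \<in> vecs (2 * p) \<and> self_dual (8 * p) (code_ab (2 * p) a b)}
           = (CARD('a) + 1) * (CARD('a) ^ 2 - CARD('a)) * (CARD('a) ^ ((p - 1) div 2) + 1) ^ 2
             * (CARD('a) ^ (p - 1) - CARD('a) ^ ((p - 1) div 2)) ^ 2"
  using card_self_dual_code_h[OF assms] card_self_dual_code_ab[OF assms] by (rule conjI)

end
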